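(* Let $n$ be an integer with $n>1$. The equation $$n^x=(n+1)^y+(n+2)^z+(n+3)^w$$ has no solution in positive integers $x,y,z,w$, except for $n=2$ or $n=3$. For $n=2$ the only solution in positive integers is $(x,y,z,w)=(5,1,1,2)$, and for $n=3$ the only solution in positive integers is $(x,y,z,w)=(3,2,1,1)$. *)

theory Defs
  imports Main
begin

end

theory Submission
  imports Defs "HOL-Number_Theory.Residues"
begin

text \<open>
  Everything rests on the residues of the equation modulo the four consecutive bases. Modulo
  \<open>n + 1\<close> it reads \<open>(-1)^x = 1 + 2^w\<close>, and modulo \<open>n + 2\<close> it reads \<open>(-2)^x = (-1)^y + 1\<close>.
  An even \<open>x\<close> therefore makes \<open>n + 1\<close> a power \<open>2^a\<close>, and an odd \<open>y\<close> makes \<open>n + 2\<close> one. The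
  relation \<open>2^a = -1\<close> modulo \<open>n + 2 = 2^a + 1\<close> excludes the first possibility (\<open>odd_x\<close>); in the
  second, the order of 2 modulo \<open>n + 1 = 2^a - 1\<close> leaves only \<open>n = 2\<close> (\<open>base_2_if_odd_y\<close>).

  In the remaining case, \<open>x\<close> odd and \<open>y\<close> even, \<open>n + 2\<close> divides \<open>2^x + 2\<close>, which is twice a number
  of the form \<open>s\<^sup>2 + 1\<close>. Odd divisors of such numbers are 1 modulo 4, because \<open>-1\<close> is not a square
  modulo a prime that is 3 modulo 4 (\<open>odd_dvd_one_plus_square\<close>). Together with
  \<open>n + 1 dvd 2^w + 2\<close> and the equation modulo 8 and 3, this decides all classes of \<open>n\<close> modulo 4:
  only \<open>n = 3\<close> with \<open>w = 1\<close> survives (\<open>base_3_if_even_y\<close>).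

  What is left are two equations with fixed bases,
  \<open>2^x = 3^y + 4^z + 5^w\<close> and \<open>3^x = 4^y + 5^z + 6\<close>. Powers of a fixed base are periodic modulo a
  fixed \<open>m\<close>, so each modulus restricts the residues of the exponents. The moduli are chosen such
  that all periods have the same few small prime factors, which makes these restrictions
  comparable with each other. Since a genuine solution exists, residues alone can never be
  contradictory; the contradiction comes from assuming an exponent to be larger than in
  the known solution, which makes its term vanish modulo a suitable power of the base.
\<close>

section \<open>Divisors of numbers of the form one plus a square\<close>

text \<open>
  If \<open>p = 4 k + 3\<close>, then \<open>(p - 1) / 2\<close> is odd, so raising \<open>s\<^sup>2 = -1\<close> to this power gives
  \<open>s^(p - 1) = -1\<close>, against Fermat's little theorem.
\<close>
lemma prime_dvd_one_plus_square:
  fixes p s :: nat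
  assumes "prime p" "odd p" "p dvd s\<^sup>2 + 1"
  shows "p mod 4 = 1"
proof (rule ccontr)
  assume "p mod 4 \<noteq> 1"
  with \<open>odd p\<close> have "p mod 4 = 3" by presburger
  then obtain k where k: "p - 1 = 2 * (2 * k + 1)"
  proof -
    have "p - 1 = 2 * (2 * (p div 4) + 1)" using \<open>p mod 4 = 3\<close> by presburger
    then show thesis using that by blast
  qed
  have "\<not> p dvd s"
  proof
    assume "p dvd s"
    then have "p dvd s\<^sup>2" by (simp add: power2_eq_square)
    then have "p dvd 1" using assms(3) dvd_add_right_iff by blast
    then show False using \<open>prime p\<close> by auto
  qed
  then have "[s ^ (p - 1) = 1] (mod p)" using fermat_theorem \<open>prime p\<close> by blast
  then have F: "[int s ^ (p - 1) = 1] (mod int p)"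
    by (metis cong_int_iff of_nat_1 of_nat_power)
  have "[(int s)\<^sup>2 = -1] (mod int p)"
    using assms(3) by (metis cong_iff_dvd_diff diff_minus_eq_add int_dvd_int_iff of_nat_1
        of_nat_add of_nat_power)
  then have "[((int s)\<^sup>2) ^ (2 * k + 1) = (-1) ^ (2 * k + 1)] (mod int p)" by (rule cong_pow)
  moreover have "((int s)\<^sup>2) ^ (2 * k + 1) = int s ^ (p - 1)" unfolding k
    by (simp only: power_mult)
  moreover have "(-1 :: int) ^ (2 * k + 1) = -1" by simp
  ultimately have "[int s ^ (p - 1) = -1] (mod int p)" by metis
  with F have "[1 = (-1::int)] (mod int p)" using cong_sym cong_trans by blast
  then have "int p dvd 2" by (simp add: cong_iff_dvd_diff)
  then have "p dvd 2" by presburger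
  then show False using \<open>odd p\<close> \<open>prime p\<close>
    by (metis primes_dvd_imp_eq two_is_prime_nat dvd_refl)
qed

lemma odd_dvd_one_plus_square_nat:
  fixes d s :: nat
  assumes "odd d" "d dvd s\<^sup>2 + 1"
  shows "d mod 4 = 1"
  using assms
proof (induction d rule: less_induct)
  case (less d)
  show ?case
  proof (cases "d = 1")
    case False
    then obtain p where p: "prime p" "p dvd d" using prime_factor_nat by blast
    then obtain e where e: "d = p * e" by blast
    have "p > 1" using p(1) by (rule prime_gt_1_nat)
    moreover have "e > 0" using less.prems(1) e by (cases e) auto
    ultimately have "e < d" using e by simp
    moreover have "odd e" "e dvd s\<^sup>2 + 1" using less.prems e by (auto dest: dvd_mult_right)
    ultimately have "e mod 4 = 1" using less.IH by blast
    moreover have "p mod 4 = 1"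
      using prime_dvd_one_plus_square[OF p(1)] less.prems e by (auto dest: dvd_mult_left)
    ultimately show ?thesis by (simp add: e mod_mult_eq[of p 4 e, symmetric])
  qed simp
qed

lemma odd_dvd_one_plus_square:
  fixes d s :: int
  assumes "odd d" "d > 0" "d dvd s\<^sup>2 + 1"
  shows "d mod 4 = 1"
proof -
  have "nat d dvd (nat \<bar>s\<bar>)\<^sup>2 + 1"
  proof -
    have "int ((nat \<bar>s\<bar>)\<^sup>2 + 1) = s\<^sup>2 + 1" by simp
    then show ?thesis using assms by (metis int_dvd_int_iff int_nat_eq less_le)
  qed
  moreover have "odd (nat d)" using assms by (simp add: even_nat_iff)
  ultimately have "nat d mod 4 = 1" by (rule odd_dvd_one_plus_square_nat[rotated])
  then have "int (nat d mod 4) = 1" by simp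
  then show ?thesis using assms(2) by (simp add: zmod_int)
qed

text \<open>
  For odd \<open>x = 2 k + 1\<close> the number \<open>2^x + 2\<close> is \<open>2 ((2^k)\<^sup>2 + 1)\<close>, so the previous lemma applies
  to \<open>m\<close> or to \<open>m / 2\<close>.
\<close>
lemma mod_4_of_dvd_two_power_plus_two:
  fixes m :: int
  assumes "m dvd 2 ^ x + 2" "odd x" "m > 0"
  shows "odd m \<Longrightarrow> m mod 4 = 1" and "m mod 4 = 2 \<Longrightarrow> m mod 8 = 2"
proof -
  obtain k where k: "x = 2 * k + 1" using \<open>odd x\<close> by (elim oddE)
  have eq: "2 ^ x + 2 = 2 * ((2 ^ k)\<^sup>2 + 1 :: int)"
    by (simp add: k power_mult power2_eq_square flip: power_add mult_2)
  show "m mod 4 = 1" if "odd m"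
  proof -
    have "m dvd (2 ^ k)\<^sup>2 + 1"
      using assms(1) that unfolding eq by (metis coprime_dvd_mult_right_iff coprime_right_2_iff_odd)
    then show ?thesis using odd_dvd_one_plus_square that assms(3) by blast
  qed
  show "m mod 8 = 2" if "m mod 4 = 2"
  proof -
    have "2 dvd m" using that by presburger
    then obtain e where e: "m = 2 * e" by (elim dvdE)
    then have "e dvd (2 ^ k)\<^sup>2 + 1" using assms(1) unfolding eq e
      by (subst (asm) dvd_mult_cancel_left) simp
    moreover have "odd e" using that e by presburger
    moreover have "e > 0" using assms(3) e by simp
    ultimately have "e mod 4 = 1" using odd_dvd_one_plus_square by blast
    then show ?thesis using e by presburger
  qed
qed

section \<open>Reduction to the bases 2 and 3\<close>

lemma dvd_two_power_imp_two_power: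
  fixes m :: int
  assumes "m dvd 2 ^ k" "m > 0"
  obtains a where "m = 2 ^ a"
proof -
  have "nat m dvd 2 ^ k" using assms
    by (metis int_dvd_int_iff int_nat_eq of_nat_numeral of_nat_power less_le)
  then obtain a where "nat m = 2 ^ a" using divides_primepow_nat two_is_prime_nat by blast
  then have "m = 2 ^ a" using assms(2) by (metis int_nat_eq less_le of_nat_numeral of_nat_power)
  then show thesis using that by blast
qed

locale four_power_equation =
  fixes n :: int and x y z w :: nat
  assumes n: "n > 1"
    and pos: "x > 0" "y > 0" "z > 0" "w > 0"
    and eq: "n ^ x = (n + 1) ^ y + (n + 2) ^ z + (n + 3) ^ w"
begin

lemma x_gt_1: "x > 1"
proof (rule ccontr)
  assume "\<not> x > 1"
  then have "x = 1" using pos by simp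
  moreover have "(n + 1) ^ y \<ge> (n + 1) ^ 1" using pos n by (intro power_increasing) auto
  moreover have "(n + 2) ^ z > 0" "(n + 3) ^ w > 0" using n by auto
  ultimately show False using eq by simp
qed

lemma cong_succ: "[(-1) ^ x = 1 + 2 ^ w] (mod (n + 1))"
proof -
  have a: "[n ^ x = (-1) ^ x] (mod (n + 1))"
    by (intro cong_pow) (simp add: cong_iff_dvd_diff add.commute)
  have "[(n + 1) ^ y + (n + 2) ^ z + (n + 3) ^ w = 0 ^ y + 1 ^ z + 2 ^ w] (mod (n + 1))"
    by (intro cong_add cong_pow) (simp_all add: cong_iff_dvd_diff add.commute)
  then show ?thesis using a eq pos by (metis add_0 cong_sym cong_trans power_one zero_power)
qed

lemma cong_succ_succ: "[(-2) ^ x = (-1) ^ y + 1] (mod (n + 2))"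
proof -
  have a: "[n ^ x = (-2) ^ x] (mod (n + 2))"
    by (intro cong_pow) (simp add: cong_iff_dvd_diff add.commute)
  have "[(n + 1) ^ y + (n + 2) ^ z + (n + 3) ^ w = (-1) ^ y + 0 ^ z + 1 ^ w] (mod (n + 2))"
    by (intro cong_add cong_pow) (simp_all add: cong_iff_dvd_diff add.commute)
  then show ?thesis using a eq pos by (metis add_0_right cong_sym cong_trans power_one zero_power)
qed

text \<open>
  For even \<open>x\<close>, \<open>n + 1\<close> is a power \<open>2^a\<close>, and modulo the odd number \<open>n + 2 = 2^a + 1\<close> the
  equation becomes \<open>2^(x - 1) = 1\<close>. As also \<open>2^a = -1\<close>, the power \<open>2^(a (x - 1))\<close> would be both
  \<open>1\<close> and \<open>(-1)^(x - 1) = -1\<close>.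
\<close>
lemma odd_x: "odd x"
proof
  assume ev: "even x"
  then have "n + 1 dvd 2 ^ w" using cong_succ by (simp add: cong_iff_dvd_diff)
  then obtain a where a: "n + 1 = 2 ^ a" using dvd_two_power_imp_two_power n
    by (metis add_pos_pos less_trans zero_less_one)
  then have "a > 0" using n by (cases a) auto
  then have "even (n + 1)" unfolding a by simp
  then have odd: "odd (n + 2)" by simp
  have even_y: "even y"
  proof (rule ccontr)
    assume "odd y"
    then have "n + 2 dvd 2 ^ x" using cong_succ_succ ev by (simp add: cong_iff_dvd_diff)
    moreover have "coprime (n + 2) (2 ^ x)" using odd by (simp add: coprime_commute)
    ultimately have "is_unit (n + 2)" using coprime_common_divisor dvd_refl by blast
    then show False using n by simp
  qed
  have "[2 ^ x = (2::int)] (mod (n + 2))" using cong_succ_succ ev even_y by simp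
  then have "[2 * 2 ^ (x - 1) = (2::int) * 1] (mod (n + 2))" using pos by (simp flip: power_Suc)
  then have "[2 ^ (x - 1) = (1::int)] (mod (n + 2))"
    using odd by (subst (asm) cong_mult_lcancel) (auto simp: coprime_commute)
  then have "[(2 ^ (x - 1)) ^ a = (1::int) ^ a] (mod (n + 2))" by (rule cong_pow)
  moreover have "[(2 ^ a) ^ (x - 1) = (-1::int) ^ (x - 1)] (mod (n + 2))"
    by (intro cong_pow) (simp add: cong_iff_dvd_diff add.commute flip: a)
  moreover have "odd (x - 1)" using ev pos by simp
  ultimately have "[-1 = (1::int)] (mod (n + 2))"
    by (metis cong_sym cong_trans mult.commute power_minus_odd power_mult power_one)
  then have "n + 2 dvd 2" by (simp add: cong_iff_dvd_diff)
  then show False using n by (auto dest: zdvd_imp_le)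
qed

lemma dvd_succ: "n + 1 dvd 2 ^ w + 2"
  using cong_succ odd_x
  by (simp add: cong_iff_dvd_diff)
    (metis add.commute dvd_minus_iff minus_add_distrib add_uminus_conv_diff)

lemma dvd_succ_succ:
  assumes "even y"
  shows "n + 2 dvd 2 ^ x + 2"
  using cong_succ_succ odd_x assms
  by (simp add: cong_iff_dvd_diff)
    (metis add.commute dvd_minus_iff minus_add_distrib add_uminus_conv_diff)

text \<open>
  Here \<open>n + 2 = 2^a\<close>, and 2 has order \<open>a\<close> modulo \<open>n + 1 = 2^a - 1\<close>. Some power of 2 is \<open>-1\<close>
  there; reducing its exponent modulo \<open>a\<close> gives \<open>2^j = -1\<close> with \<open>j < a\<close>, and then
  \<open>2^a - 1 \<le> 2^j + 1\<close> leaves room only for \<open>a = 2\<close>.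
\<close>
lemma base_2_if_odd_y:
  assumes "odd y"
  shows "n = 2"
proof -
  have "n + 2 dvd 2 ^ x" using cong_succ_succ odd_x assms by (simp add: cong_iff_dvd_diff)
  then obtain a where a: "n + 2 = 2 ^ a" using dvd_two_power_imp_two_power n
    by (metis add_pos_pos less_trans zero_less_one zero_less_numeral)
  then have "a > 1" using n by (cases a; cases "a - 1") auto
  define b where "b = a - 1"
  have b: "a = Suc b" "b > 0" using \<open>a > 1\<close> by (auto simp: b_def)
  have "even (n + 2)" unfolding a using b by simp
  then have "odd (n + 1)" by simp
  moreover have "2 ^ w + 2 = 2 * (2 ^ (w - 1) + 1 :: int)" using pos by (cases w) auto
  ultimately have "n + 1 dvd 2 ^ (w - 1) + 1"
    using dvd_succ by (metis coprime_dvd_mult_right_iff coprime_right_2_iff_odd)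
  then have "[2 ^ (w - 1) = (-1::int)] (mod (n + 1))" by (simp add: cong_iff_dvd_diff)
  moreover have "[2 ^ (w - 1) = (2::int) ^ ((w - 1) mod a)] (mod (n + 1))"
  proof -
    have "[(2 ^ a) ^ ((w - 1) div a) * 2 ^ ((w - 1) mod a)
      = 1 ^ ((w - 1) div a) * (2::int) ^ ((w - 1) mod a)] (mod (n + 1))"
      by (intro cong_mult cong_pow cong_refl) (simp add: cong_iff_dvd_diff add.commute flip: a)
    then show ?thesis by (simp flip: power_mult power_add)
  qed
  ultimately have "[2 ^ ((w - 1) mod a) = (-1::int)] (mod (n + 1))"
    using cong_sym cong_trans by blast
  then have "n + 1 dvd 2 ^ ((w - 1) mod a) + 1" by (simp add: cong_iff_dvd_diff)
  then have "n + 1 \<le> 2 ^ ((w - 1) mod a) + 1" by (rule zdvd_imp_le) (simp add: add_pos_pos)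
  moreover have "(2::int) ^ ((w - 1) mod a) \<le> 2 ^ b"
    using b by (intro power_increasing) (auto simp: less_Suc_eq_le[symmetric])
  moreover have "n + 2 = 2 * 2 ^ b" using a b by simp
  ultimately show "n = 2" using n by linarith
qed

text \<open>
  The divisibility of \<open>2^x + 2\<close> by \<open>n + 2\<close> lifts \<open>n mod 4 = 0\<close> to \<open>n mod 8 = 0\<close>. The equation
  modulo 8, that is \<open>1 + 2^z + 3^w = 0\<close>, then forces \<open>z = 2\<close> and \<open>w\<close> odd. With the parities of all
  exponents known, the equation fails modulo 3 in each residue class of \<open>n\<close>.
\<close>
lemma base_mod_4_neq_0:
  assumes "even y"
  shows "n mod 4 \<noteq> 0"
proof
  assume "n mod 4 = 0"
  then have "(n + 2) mod 4 = 2" by presburger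
  then have "(n + 2) mod 8 = 2" using mod_4_of_dvd_two_power_plus_two(2)[OF dvd_succ_succ[OF assms] odd_x] n
    by simp
  then have n8: "n mod 8 = 0" by presburger
  have "n ^ x mod 8 = (n mod 8) ^ x mod 8" by (simp add: power_mod)
  then have "n ^ x mod 8 = 0" using n8 pos by (simp add: zero_power)
  moreover have "(n + 1) ^ y mod 8 = 1"
  proof -
    have "(n + 1) mod 8 = 1" using n8 by presburger
    then show ?thesis by (metis power_mod power_one mod_mod_trivial)
  qed
  moreover have "(n + 2) ^ z mod 8 = 2 ^ z mod 8"
  proof -
    have "(n + 2) mod 8 = 2" using n8 by presburger
    then show ?thesis by (metis power_mod)
  qed
  moreover have "(n + 3) ^ w mod 8 = 3 ^ w mod 8"
  proof -
    have "(n + 3) mod 8 = 3" using n8 by presburger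
    then show ?thesis by (metis power_mod)
  qed
  ultimately have sum8: "(1 + (2 ^ z mod 8) + (3 ^ w mod 8)) mod (8::int) = 0"
    using eq by (metis mod_add_eq mod_mod_trivial)
  have w8: "(3::int) ^ w mod 8 = (if odd w then 3 else 1)"
  proof (induction w)
    case (Suc w)
    have "(3::int) ^ Suc w mod 8 = 3 * (3 ^ w mod 8) mod 8" by (simp add: mod_mult_right_eq)
    then show ?case using Suc by simp
  qed simp
  have "z = 2"
  proof (rule ccontr)
    assume "z \<noteq> 2"
    then consider "z = 1" | "z \<ge> 3" using pos by linarith
    then show False
    proof cases
      case 2
      then have "(2::int) ^ 3 dvd 2 ^ z" by (rule le_imp_power_dvd)
      then have "(2::int) ^ z mod 8 = 0" by (simp add: mod_eq_0_iff_dvd)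
      then show False using sum8 w8 by (auto split: if_splits)
    qed (use sum8 w8 in \<open>auto split: if_splits\<close>)
  qed
  then have "odd w" using sum8 w8 by (auto split: if_splits)
  have x3: "n ^ x mod 3 = (n mod 3) ^ x mod 3" by (simp add: power_mod)
  have y3: "(n + 1) ^ y mod 3 = ((n + 1) mod 3) ^ y mod 3"
    and z3: "(n + 2) ^ z mod 3 = ((n + 2) mod 3) ^ z mod 3"
    by (simp_all only: power_mod)
  have w3: "(n + 3) ^ w mod 3 = (n mod 3) ^ w mod 3" by (metis mod_add_self2 power_mod)
  have sum3: "n ^ x mod 3 = ((n + 1) ^ y mod 3 + (n + 2) ^ z mod 3 + (n + 3) ^ w mod 3) mod 3"
    unfolding eq by (metis mod_add_eq mod_mod_trivial)
  have sq: "(2::int) ^ k mod 3 = (if odd k then 2 else 1)" for k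
  proof (induction k)
    case (Suc k)
    have "(2::int) ^ Suc k mod 3 = 2 * (2 ^ k mod 3) mod 3" by (simp add: mod_mult_right_eq)
    then show ?case using Suc by simp
  qed simp
  have "n mod 3 = 0 \<or> n mod 3 = 1 \<or> n mod 3 = 2" by presburger
  then consider "n mod 3 = 0" | "n mod 3 = 1" | "n mod 3 = 2" by metis
  then show False
  proof cases
    case 1
    then have "(n + 1) mod 3 = 1" "(n + 2) mod 3 = 2" by presburger+
    with 1 show False using sum3 pos \<open>z = 2\<close>
      unfolding x3 y3 z3 w3 by (simp add: zero_power)
  next
    case 2
    then have "(n + 1) mod 3 = 2" "(n + 2) mod 3 = 0" by presburger+
    with 2 show False using sum3 pos assms \<open>z = 2\<close>
      unfolding x3 y3 z3 w3 by (simp add: sq)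
  next
    case 3
    then have "(n + 1) mod 3 = 0" "(n + 2) mod 3 = 1" by presburger+
    with 3 show False using sum3 pos odd_x \<open>odd w\<close>
      unfolding x3 y3 z3 w3 by (simp add: sq zero_power)
  qed
qed

text \<open>
  By the divisibility \<open>n + 2 dvd 2^x + 2\<close>, \<open>n mod 4 = 1\<close> would give an odd divisor that is 3 modulo 4,
  and \<open>n mod 4 = 2\<close> would make \<open>2^x + 2\<close> a multiple of 4, hence \<open>x = 1\<close>. For \<open>n mod 4 = 3\<close> the same argument with
  \<open>n + 1 dvd 2^w + 2\<close> leaves \<open>w = 1\<close>, hence \<open>n + 1 = 4\<close>.
\<close>
lemma base_3_if_even_y:
  assumes "even y"
  shows "n = 3 \<and> w = 1"
proof -
  note dvd2 = dvd_succ_succ[OF assms]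
  have four: "k = 1" if "4 dvd (2::int) ^ k + 2" "k > 0" for k
  proof (rule ccontr)
    assume "k \<noteq> 1"
    then have "(2::int) ^ 2 dvd 2 ^ k" using that(2) by (intro le_imp_power_dvd) auto
    then show False using that(1) by (simp add: dvd_add_right_iff)
  qed
  consider "n mod 4 = 0" | "n mod 4 = 1" | "n mod 4 = 2" | "n mod 4 = 3" by fastforce
  then show ?thesis
  proof cases
    case 1
    then show ?thesis using base_mod_4_neq_0[OF assms] by simp
  next
    case 2
    then have "odd (n + 2)" "(n + 2) mod 4 = 3" by presburger+
    then show ?thesis using mod_4_of_dvd_two_power_plus_two(1)[OF dvd2 odd_x] n by simp
  next
    case 3
    then have "4 dvd n + 2" by presburger
    then have "x = 1" using four dvd2 pos dvd_trans by blast
    then show ?thesis using x_gt_1 by simp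
  next
    case 4
    then have d: "4 dvd n + 1" by presburger
    then have "w = 1" using four dvd_succ pos dvd_trans by blast
    then have "n + 1 \<le> 4" using dvd_succ by (intro zdvd_imp_le) auto
    then have "n = 3" using n d by presburger
    then show ?thesis using \<open>w = 1\<close> by simp
  qed
qed

end

section \<open>Sieving exponents\<close>

text \<open>
  A property of a number that depends only on its residue modulo \<open>L\<close> need only be tested on
  \<open>0, \<dots>, L - 1\<close>. The rule is meant for the \<open>induct\<close> method, and lets the simplifier do the tests: it
  unrolls intervals between numerals, so the interval starts at 2, and 0 and 1 stand apart.
\<close>
lemma residue_check:
  fixes x L :: nat
  assumes "L > 0" "P (x mod L) = P x" "P 0" "P 1" "list_all P [2..<L]"
  shows "P x"
proof -
  have "x mod L = 0 \<or> x mod L = 1 \<or> x mod L \<in> {2..<L}" using \<open>L > 0\<close> by auto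
  then show ?thesis using assms by (auto simp: list_all_iff)
qed

lemma power_mod_exponent:
  fixes a m :: int
  assumes "a ^ l mod m = 1"
  shows "a ^ e mod m = a ^ (e mod l) mod m"
proof -
  have "a ^ e = (a ^ l) ^ (e div l) * a ^ (e mod l)" by (simp flip: power_mult power_add)
  then have "a ^ e mod m = ((a ^ l mod m) ^ (e div l) mod m) * a ^ (e mod l) mod m"
    by (metis mod_mult_left_eq power_mod)
  then show ?thesis by (metis assms mult_1 mod_mult_left_eq power_one)
qed

lemma power_mod_eq_0:
  fixes a m :: int
  assumes "a ^ i mod m = 0" "i \<le> e"
  shows "a ^ e mod m = 0"
  using assms by (meson dvd_trans le_imp_power_dvd mod_eq_0_iff_dvd)

text \<open>
  A modulus \<open>m\<close> turns the equation into a condition on the residues of the exponents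
  modulo the periods \<open>l\<close>, \<open>l'\<close>, \<open>l''\<close> of the three powers. If \<open>m\<close> is a divisor of \<open>a^i\<close> with \<open>i \<le> x\<close>, or
  similarly for one of the other bases, that power drops out; these are the three variants.
\<close>
context
  fixes a b c k m :: int and x y z :: nat
  assumes eq: "a ^ x = b ^ y + c ^ z + k"
begin

lemma mod_terms: "a ^ x mod m = (b ^ y mod m + c ^ z mod m + k) mod m"
  unfolding eq by (metis mod_add_left_eq mod_add_eq)

lemma sieve:
  assumes "a ^ l mod m = 1" "b ^ l' mod m = 1" "c ^ l'' mod m = 1"
  shows "a ^ (x mod l) mod m = (b ^ (y mod l') mod m + c ^ (z mod l'') mod m + k) mod m"
  using mod_terms power_mod_exponent assms by metis

lemma sieve_left_0:
  assumes "a ^ i mod m = 0" "i \<le> x" "b ^ l' mod m = 1" "c ^ l'' mod m = 1"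
  shows "(b ^ (y mod l') mod m + c ^ (z mod l'') mod m + k) mod m = 0"
  using mod_terms power_mod_eq_0[OF assms(1,2)] power_mod_exponent assms(3,4) by metis

lemma sieve_mid_0:
  assumes "a ^ l mod m = 1" "b ^ i mod m = 0" "i \<le> y" "c ^ l'' mod m = 1"
  shows "a ^ (x mod l) mod m = (c ^ (z mod l'') mod m + k) mod m"
  using mod_terms power_mod_eq_0[OF assms(2,3)] power_mod_exponent assms(1,4) by (metis add_0)

lemma sieve_right_0:
  assumes "a ^ l mod m = 1" "b ^ l' mod m = 1" "c ^ i mod m = 0" "i \<le> z"
  shows "a ^ (x mod l) mod m = (b ^ (y mod l') mod m + k) mod m"
  using mod_terms power_mod_eq_0[OF assms(3,4)] power_mod_exponent assms(1,2) by (metis add_0_right)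

end

section \<open>Base 2\<close>

text \<open>
  For \<open>x \<ge> 6\<close> the left side vanishes modulo 64, which ties \<open>w\<close> to \<open>y\<close> modulo 16. The periods of 2, 3
  and 5 modulo 17 divide 16 as well, so 17 sieves the same residues and leaves a single triple.
  For that triple \<open>5^w = -1\<close> modulo 13, and no values of \<open>2^x\<close> and \<open>3^y\<close> modulo 13 that are still
  possible satisfy the equation.
\<close>
lemma two_power_exponent_less_6:
  fixes x y w :: nat
  assumes eq: "(2::int) ^ x = 3 ^ y + 5 ^ w + 4" and par: "odd x" "odd y" "even w"
  shows "x < 6"
proof (rule ccontr)
  assume "\<not> x < 6"
  then have x: "6 \<le> x" by simp
  have "y mod 16 = 1 \<or> y mod 16 = 3 \<or> y mod 16 = 5 \<or> y mod 16 = 7 \<or>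
    y mod 16 = 9 \<or> y mod 16 = 11 \<or> y mod 16 = 13 \<or> y mod 16 = 15"
    using par(2)
    by (induct y rule: residue_check[where L = 16]) (simp_all add: mod_mod_cancel dvd_mod_iff)
  moreover have "w mod 16 = 0 \<or> w mod 16 = 2 \<or> w mod 16 = 4 \<or> w mod 16 = 6 \<or>
    w mod 16 = 8 \<or> w mod 16 = 10 \<or> w mod 16 = 12 \<or> w mod 16 = 14"
    using par(3)
    by (induct w rule: residue_check[where L = 16]) (simp_all add: mod_mod_cancel dvd_mod_iff)
  ultimately have 64: "y mod 16 = 1 \<and> w mod 16 = 10 \<or> y mod 16 = 3 \<and> w mod 16 = 8 \<or>
    y mod 16 = 5 \<and> w mod 16 = 6 \<or> y mod 16 = 7 \<and> w mod 16 = 4 \<or>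
    y mod 16 = 9 \<and> w mod 16 = 2 \<or> y mod 16 = 11 \<and> w mod 16 = 0 \<or>
    y mod 16 = 13 \<and> w mod 16 = 14 \<or> y mod 16 = 15 \<and> w mod 16 = 12"
    using sieve_left_0[OF eq, of 6 64 16 16] x by (elim disjE conjE) simp_all
  have "x mod 8 = 1 \<or> x mod 8 = 3 \<or> x mod 8 = 5 \<or> x mod 8 = 7"
    using par(1)
    by (induct x rule: residue_check[where L = 8]) (simp_all add: mod_mod_cancel dvd_mod_iff)
  then have 17: "x mod 8 = 7 \<and> y mod 16 = 9 \<and> w mod 16 = 2"
    using 64 sieve[OF eq, of 8 17 16 16, simplified] by (elim disjE conjE) simp_all
  from 17 have "x mod 8 = 7" "w mod 16 = 2" by auto
  from \<open>w mod 16 = 2\<close> have "w mod 4 = 2"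
    using mod_mod_cancel[of 4 16 w] by simp
  moreover from \<open>x mod 8 = 7\<close> have "x mod 12 = 3 \<or> x mod 12 = 7 \<or> x mod 12 = 11"
    by (induct x rule: residue_check[where L = 24]) (simp_all add: mod_mod_cancel dvd_mod_iff)
  moreover have "y mod 3 = 0 \<or> y mod 3 = 1 \<or> y mod 3 = 2" by presburger
  ultimately show False
    using sieve[OF eq, of 12 13 3 4, simplified] by (elim disjE conjE) simp_all
qed

text \<open>
  The moduli 3 and 8 give \<open>w\<close> even and \<open>z = 1\<close>; the previous lemma then bounds all terms by 32.
\<close>
lemma solution_base_2:
  fixes x y z w :: nat
  assumes pos: "y > 0" "z > 0" "w > 0"
    and eq: "(2::int) ^ x = 3 ^ y + 4 ^ z + 5 ^ w" and par: "odd x" "odd y"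
  shows "(x, y, z, w) = (5, 1, 1, 2)"
proof -
  have ge: "(3::int) ^ y \<ge> 3 ^ 1" "(4::int) ^ z \<ge> 4 ^ 1" "(5::int) ^ w \<ge> 5 ^ 1"
    using pos by (intro power_increasing; simp)+
  have x: "x \<ge> 3"
  proof (rule ccontr)
    assume "\<not> x \<ge> 3"
    then have "(2::int) ^ x \<le> 2 ^ 2" by (intro power_increasing) auto
    then show False using eq ge by simp
  qed
  have eq': "(2::int) ^ x = 3 ^ y + 5 ^ w + 4 ^ z" using eq by simp
  have y8: "(3::int) ^ y mod 8 = 3"
    using par power_mod_exponent[of 3 2 8 y] by (simp add: odd_iff_mod_2_eq_one)
  have x8: "(2::int) ^ x mod 8 = 0" using power_mod_eq_0[of 2 3 8 x] x by simp
  have w: "even w"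
  proof (rule ccontr)
    assume "odd w"
    then have "(5::int) ^ w mod 3 = 2"
      using power_mod_exponent[of 5 2 3 w] by (simp add: odd_iff_mod_2_eq_one)
    moreover have "(3::int) ^ y mod 3 = 0" using power_mod_eq_0[of 3 1 3 y] pos by simp
    moreover have "(4::int) ^ z mod 3 = 1" using power_mod_exponent[of 4 1 3 z] by simp
    moreover have "(2::int) ^ x mod 3 = 2"
      using power_mod_exponent[of 2 2 3 x] par by (simp add: odd_iff_mod_2_eq_one)
    ultimately show False using mod_terms[OF eq', of 3] by presburger
  qed
  then have w8: "(5::int) ^ w mod 8 = 1"
    using power_mod_exponent[of 5 2 8 w] by (simp add: even_iff_mod_2_eq_zero)
  have z: "z = 1"
  proof (rule ccontr)
    assume "z \<noteq> 1"
    then have "(4::int) ^ z mod 8 = 0" using power_mod_eq_0[of 4 2 8 z] pos by simp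
    then show False using mod_terms[OF eq', of 8] x8 y8 w8 by presburger
  qed
  have eq2: "(2::int) ^ x = 3 ^ y + 5 ^ w + 4" using eq' z by simp
  have "x < 6" using two_power_exponent_less_6[OF eq2 par w] .
  then have "x = 3 \<or> x = 5" using x par by presburger
  then have le: "(2::int) ^ x \<le> 32" by auto
  have "y < 4"
  proof (rule ccontr)
    assume "\<not> y < 4"
    then have "(3::int) ^ y \<ge> 3 ^ 4" by (intro power_increasing) auto
    then show False using le eq2 ge by simp
  qed
  have "w < 3"
  proof (rule ccontr)
    assume "\<not> w < 3"
    then have "(5::int) ^ w \<ge> 5 ^ 3" by (intro power_increasing) auto
    then show False using le eq2 ge by simp
  qed
  then have "w = 2" using w pos by presburger
  moreover have "y = 1 \<or> y = 3" using \<open>y < 4\<close> par by presburger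
  ultimately show ?thesis using eq2 z \<open>x = 3 \<or> x = 5\<close> by (elim disjE) simp_all
qed

section \<open>Base 3\<close>

text \<open>
  The moduli 9, 7, 13 have periods dividing 12 and fix the exponents modulo 12 (\<open>y\<close> modulo 6); then
  27, 19, 37 with periods dividing 36 lift this to the residues of the solution \<open>(3, 2, 1)\<close> modulo 36
  (\<open>y\<close> modulo 18). The powers of 3 are usable as moduli because \<open>x \<ge> 3\<close>.
\<close>
lemma three_power_exponents_mod_36:
  fixes x y z :: nat
  assumes eq: "(3::int) ^ x = 4 ^ y + 5 ^ z + 6" and "x \<ge> 3"
    and mod4: "x mod 4 = 3" "even y" "z mod 4 = 1"
  shows "x mod 36 = 3 \<and> y mod 18 = 2 \<and> z mod 36 = 1"
proof -
  have "y mod 3 = 0 \<or> y mod 3 = 1 \<or> y mod 3 = 2" by presburger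
  moreover have "z mod 6 = 1 \<or> z mod 6 = 3 \<or> z mod 6 = 5"
    using mod4(3)
    by (induct z rule: residue_check[where L = 12]) (simp_all add: mod_mod_cancel dvd_mod_iff)
  ultimately have 9: "y mod 3 = 2 \<and> z mod 6 = 1 \<or> y mod 3 = 1 \<and> z mod 6 = 3 \<or> y mod 3 = 0 \<and> z mod 6 = 5"
    using sieve_left_0[OF eq, of 2 9 3 6] \<open>x \<ge> 3\<close> by (elim disjE conjE) simp_all
  have "x mod 6 = 1 \<or> x mod 6 = 3 \<or> x mod 6 = 5"
    using mod4(1)
    by (induct x rule: residue_check[where L = 12]) (simp_all add: mod_mod_cancel dvd_mod_iff)
  then have "x mod 6 = 3 \<and> y mod 3 = 2 \<and> z mod 6 = 1 \<or> x mod 6 = 1 \<and> y mod 3 = 0"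
    using 9 sieve[OF eq, of 6 7 3 6, simplified] by (elim disjE conjE) simp_all
  then have x1: "x mod 6 = 3 \<and> y mod 3 = 2 \<and> z mod 6 = 1"
  proof
    assume "x mod 6 = 1 \<and> y mod 3 = 0"
    then have "x mod 6 = 1" "y mod 3 = 0" by auto
    from \<open>x mod 6 = 1\<close> have "x mod 3 = 1"
      using mod_mod_cancel[of 3 6 x] by simp
    moreover from \<open>y mod 3 = 0\<close> mod4(2) have "y mod 6 = 0"
      by (induct y rule: residue_check[where L = 6]) (simp_all add: mod_mod_cancel dvd_mod_iff)
    ultimately show ?thesis using mod4 sieve[OF eq, of 3 13 6 4] by simp
  qed
  then have "x mod 6 = 3" "y mod 3 = 2" "z mod 6 = 1" by auto
  from \<open>x mod 6 = 3\<close> have x18: "x mod 18 = 3 \<or> x mod 18 = 9 \<or> x mod 18 = 15"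
    by (induct x rule: residue_check[where L = 18]) (simp_all add: mod_mod_cancel dvd_mod_iff)
  from \<open>y mod 3 = 2\<close> have "y mod 9 = 2 \<or> y mod 9 = 5 \<or> y mod 9 = 8"
    by (induct y rule: residue_check[where L = 9]) (simp_all add: mod_mod_cancel dvd_mod_iff)
  moreover from \<open>z mod 6 = 1\<close> have "z mod 18 = 1 \<or> z mod 18 = 7 \<or> z mod 18 = 13"
    by (induct z rule: residue_check[where L = 18]) (simp_all add: mod_mod_cancel dvd_mod_iff)
  ultimately have 27: "y mod 9 = 2 \<and> z mod 18 = 1 \<or> y mod 9 = 5 \<and> z mod 18 = 13 \<or> y mod 9 = 8 \<and> z mod 18 = 7"
    using sieve_left_0[OF eq, of 3 27 9 18] \<open>x \<ge> 3\<close> by (elim disjE conjE) simp_all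
  then have "y mod 9 = 2 \<and> z mod 9 = 1 \<or> y mod 9 = 5 \<and> z mod 9 = 4 \<or> y mod 9 = 8 \<and> z mod 9 = 7"
    using mod_mod_cancel[of 9 18 z] by auto
  then have 19: "x mod 18 = 3 \<and> (y mod 9 = 2 \<and> z mod 9 = 1 \<or> y mod 9 = 8 \<and> z mod 9 = 7)"
    using x18 sieve[OF eq, of 18 19 9 9, simplified] by (elim disjE conjE) simp_all
  moreover from mod4(2) have "(y mod 9 = 2 \<longrightarrow> y mod 18 = 2) \<and> (y mod 9 = 8 \<longrightarrow> y mod 18 = 8)"
    by (induct y rule: residue_check[where L = 18]) (simp_all add: mod_mod_cancel dvd_mod_iff)
  moreover from mod4(3) have "(z mod 9 = 1 \<longrightarrow> z mod 36 = 1) \<and> (z mod 9 = 7 \<longrightarrow> z mod 36 = 25)"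
    by (induct z rule: residue_check[where L = 36]) (simp_all add: mod_mod_cancel dvd_mod_iff)
  ultimately have "y mod 18 = 2 \<and> z mod 36 = 1 \<or> y mod 18 = 8 \<and> z mod 36 = 25" by blast
  then have "y mod 18 = 2 \<and> z mod 36 = 1"
    using 19 sieve[OF eq, of 18 37 18 36, simplified] by (elim disjE conjE) simp_all
  moreover from 19 have "x mod 18 = 3" by simp
  with mod4(1) have "x mod 36 = 3"
    by (induct x rule: residue_check[where L = 36]) (simp_all add: mod_mod_cancel dvd_mod_iff)
  ultimately show ?thesis by blast
qed

text \<open>
  Modulo 73, where 5 has order 72 and \<open>5^36 = -1\<close>, the residue of \<open>z\<close> lifts from 36 to 72, which
  gives \<open>z = 1\<close> modulo 8. If \<open>y \<ge> 3\<close>, then \<open>4^y\<close> vanishes modulo 64, and the remaining relation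
  between \<open>x\<close> and \<open>z\<close> modulo 16 is incompatible with the equation modulo 17.
\<close>
lemma three_power_eq_imp_y_eq_2:
  fixes x y z :: nat
  assumes eq: "(3::int) ^ x = 4 ^ y + 5 ^ z + 6"
    and 36: "x mod 36 = 3" "y mod 18 = 2" "z mod 36 = 1"
  shows "y = 2"
proof (rule ccontr)
  assume "y \<noteq> 2"
  then have y: "y \<ge> 3" using 36(2) by presburger
  have "x mod 12 = 3"
    using 36(1) mod_mod_cancel[of 12 36 x] by simp
  moreover have "y mod 9 = 2"
    using 36(2) mod_mod_cancel[of 9 18 y] by simp
  moreover have "z mod 72 = 1 \<or> z mod 72 = 37"
    using 36(3)
    by (induct z rule: residue_check[where L = 72]) (simp_all add: mod_mod_cancel dvd_mod_iff)
  ultimately have "z mod 72 = 1" using sieve[OF eq, of 12 73 9 72, simplified]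
    by (elim disjE conjE) simp_all
  then have "z mod 16 = 1 \<or> z mod 16 = 9"
    by (induct z rule: residue_check[where L = 144]) (simp_all add: mod_mod_cancel dvd_mod_iff)
  moreover have "x mod 16 = 3 \<or> x mod 16 = 7 \<or> x mod 16 = 11 \<or> x mod 16 = 15"
    using 36(1)
    by (induct x rule: residue_check[where L = 144]) (simp_all add: mod_mod_cancel dvd_mod_iff)
  ultimately have 64: "x mod 16 = 7 \<and> z mod 16 = 1 \<or> x mod 16 = 15 \<and> z mod 16 = 9"
    using sieve_mid_0[OF eq, of 16 64 3 16] y by (elim disjE conjE) simp_all
  moreover have "y mod 4 = 0 \<or> y mod 4 = 2"
    using 36(2)
    by (induct y rule: residue_check[where L = 36]) (simp_all add: mod_mod_cancel dvd_mod_iff)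
  ultimately show False using sieve[OF eq, of 16 17 4 16, simplified] by (elim disjE conjE) simp_all
qed

text \<open>
  If \<open>z \<ge> 2\<close>, then \<open>5^z\<close> vanishes modulo 25, which determines \<open>x\<close> modulo 20. As 5 has
  order 5 modulo 11 and order 20 modulo 41, the first of these primes determines \<open>z\<close> modulo 20
  (its residue modulo 4 is given), and the second one rules that residue out.
\<close>
lemma three_power_eq_imp_z_eq_1:
  fixes x z :: nat
  assumes eq: "(3::int) ^ x = 4 ^ 2 + 5 ^ z + 6" and 4: "x mod 4 = 3" "z mod 4 = 1"
  shows "z = 1"
proof (rule ccontr)
  assume "z \<noteq> 1"
  then have z: "z \<ge> 2" using 4(2) by presburger
  have "x mod 20 = 3 \<or> x mod 20 = 7 \<or> x mod 20 = 11 \<or> x mod 20 = 15 \<or> x mod 20 = 19"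
    using 4(1)
    by (induct x rule: residue_check[where L = 20]) (simp_all add: mod_mod_cancel dvd_mod_iff)
  then have "x mod 20 = 11"
    using sieve_right_0[OF eq, of 20 25 10 2] z by (elim disjE conjE) simp_all
  then have "x mod 5 = 1"
    using mod_mod_cancel[of 5 20 x] by simp
  moreover have "z mod 5 = 0 \<or> z mod 5 = 1 \<or> z mod 5 = 2 \<or> z mod 5 = 3 \<or> z mod 5 = 4"
    by presburger
  ultimately have "z mod 5 = 2"
    using sieve[OF eq, of 5 11 5 5, simplified] by (elim disjE conjE) simp_all
  with 4(2) have "z mod 20 = 17"
    by (induct z rule: residue_check[where L = 20]) (simp_all add: mod_mod_cancel dvd_mod_iff)
  moreover have "x mod 8 = 3 \<or> x mod 8 = 7"
    using 4(1)
    by (induct x rule: residue_check[where L = 8]) (simp_all add: mod_mod_cancel dvd_mod_iff)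
  ultimately show False using sieve[OF eq, of 8 41 10 20, simplified] by (elim disjE conjE) simp_all
qed

lemma solution_base_3:
  fixes x y z :: nat
  assumes pos: "y > 0" "z > 0"
    and eq: "(3::int) ^ x = 4 ^ y + 5 ^ z + 6" and par: "odd x" "even y"
  shows "(x, y, z) = (3, 2, 1)"
proof -
  have y2: "y \<ge> 2" using par pos by presburger
  have ge: "(4::int) ^ y \<ge> 4 ^ 2" "(5::int) ^ z \<ge> 5 ^ 1"
    using pos y2 by (intro power_increasing; simp)+
  have x: "x \<ge> 3"
  proof (rule ccontr)
    assume "\<not> x \<ge> 3"
    then have "(3::int) ^ x \<le> 3 ^ 2" by (intro power_increasing) auto
    then show False using eq ge by simp
  qed
  have x4: "x mod 4 = 3"
  proof -
    have "x mod 4 = 1 \<or> x mod 4 = 3" "y mod 2 = 0" using par by presburger+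
    then show ?thesis using sieve_right_0[OF eq, of 4 5 2 1] pos by (elim disjE conjE) simp_all
  qed
  have "z mod 4 = 0 \<or> z mod 4 = 1 \<or> z mod 4 = 2 \<or> z mod 4 = 3" by presburger
  then have z4: "z mod 4 = 1"
    using x4 sieve_mid_0[OF eq, of 4 16 2 4] y2 by (elim disjE) auto
  note 36 = three_power_exponents_mod_36[OF eq x x4 par(2) z4]
  have y: "y = 2" using three_power_eq_imp_y_eq_2[OF eq] 36 by blast
  have z: "z = 1" using three_power_eq_imp_z_eq_1 eq x4 z4 unfolding y by blast
  have "(3::int) ^ x = 3 ^ 3" using eq y z by simp
  then have "x = 3" by (subst (asm) power_inject_exp) auto
  then show ?thesis using y z by simp
qed

section \<open>Solutions for all bases\<close>

theorem theorem1:
  fixes n :: int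
  assumes "n > 1"
  shows "(n \<noteq> 2 \<and> n \<noteq> 3 \<longrightarrow>
            \<not> (\<exists>x y z w :: nat. x > 0 \<and> y > 0 \<and> z > 0 \<and> w > 0 \<and>
                 n ^ x = (n + 1) ^ y + (n + 2) ^ z + (n + 3) ^ w))
       \<and> (n = 2 \<longrightarrow>
            {(x, y, z, w) | x y z w :: nat. x > 0 \<and> y > 0 \<and> z > 0 \<and> w > 0 \<and>
                 n ^ x = (n + 1) ^ y + (n + 2) ^ z + (n + 3) ^ w} = {(5, 1, 1, 2)})
       \<and> (n = 3 \<longrightarrow>
            {(x, y, z, w) | x y z w :: nat. x > 0 \<and> y > 0 \<and> z > 0 \<and> w > 0 \<and>
                 n ^ x = (n + 1) ^ y + (n + 2) ^ z + (n + 3) ^ w} = {(3, 2, 1, 1)})"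
proof (intro conjI impI notI)
  assume "n \<noteq> 2 \<and> n \<noteq> 3"
    and "\<exists>x y z w :: nat. x > 0 \<and> y > 0 \<and> z > 0 \<and> w > 0 \<and>
                 n ^ x = (n + 1) ^ y + (n + 2) ^ z + (n + 3) ^ w"
  then obtain x y z w where "four_power_equation n x y z w" and ne: "n \<noteq> 2" "n \<noteq> 3"
    using assms unfolding four_power_equation_def by blast
  then interpret four_power_equation n x y z w by simp
  show False using base_2_if_odd_y base_3_if_even_y ne by blast
next
  assume base: "n = 2"
  have "(x, y, z, w) = (5, 1, 1, 2)"
    if pos: "x > 0" "y > 0" "z > 0" "w > 0"
      and eq: "n ^ x = (n + 1) ^ y + (n + 2) ^ z + (n + 3) ^ w" for x y z w
  proof -
    interpret four_power_equation n x y z w using that assms by unfold_locales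
    have "odd y" using base_3_if_even_y base by auto
    then show ?thesis using solution_base_2[of y z w x] pos eq odd_x base by simp
  qed
  then show "{(x, y, z, w) | x y z w :: nat. x > 0 \<and> y > 0 \<and> z > 0 \<and> w > 0 \<and>
                 n ^ x = (n + 1) ^ y + (n + 2) ^ z + (n + 3) ^ w} = {(5, 1, 1, 2)}"
    using base by auto
next
  assume base: "n = 3"
  have "(x, y, z, w) = (3, 2, 1, 1)"
    if pos: "x > 0" "y > 0" "z > 0" "w > 0"
      and eq: "n ^ x = (n + 1) ^ y + (n + 2) ^ z + (n + 3) ^ w" for x y z w
  proof -
    interpret four_power_equation n x y z w using that assms by unfold_locales
    have ev: "even y" using base_2_if_odd_y base by auto
    then have w: "w = 1" using base_3_if_even_y by blast
    have "(x, y, z) = (3, 2, 1)" using solution_base_3[of y z x] pos eq odd_x ev base w by simp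
    then show ?thesis using w by simp
  qed
  then show "{(x, y, z, w) | x y z w :: nat. x > 0 \<and> y > 0 \<and> z > 0 \<and> w > 0 \<and>
                 n ^ x = (n + 1) ^ y + (n + 2) ^ z + (n + 3) ^ w} = {(3, 2, 1, 1)}"
    using base by auto
qed

end
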